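(* Let $\Gamma=\langle\alpha_1,\ldots,\alpha_k\rangle\subset\mathbb N^d$ be an affine semigroup and let $H$ be its Graver basis. For $\beta\in\mathbb Z^d$ define a graph $T_\beta$ on vertex set $\mathsf Z(\beta)$ recursively as follows (with $\mathsf Z(\beta)=\emptyset$ if $\beta\notin\Gamma$): if $|\mathsf Z(\beta)|\le 1$, $T_\beta$ has no edges; otherwise, let $E'$ be the set of $(z,w)\in H$ with $z,w\in\mathsf Z(\beta)$, for each $i\le k$ let $T_i$ be the image of $T_{\beta-\alpha_i}$ under the cover morphism $\psi_i$ (i.e. vertices $z\mapsto z+e_i$, edges $\{z,w\}\mapsto\{z+e_i,w+e_i\}$), and let $T_\beta$ be the output of Kruskal's algorithm applied to the graph $(\mathsf Z(\beta),E(T_1)\cup\cdots\cup E(T_k)\cup E')$ with edge weights $\mathrm{dist}$, i.e. a spanning tree of that graph of minimal total edge weight. Then for every $\gamma\in\Gamma$, $\max\{\mathrm{dist}(z,w):\{z,w\}\in E(T_\gamma)\}$ (taken to be $0$ if $T_\gamma$ has no edges) equals the catenary degree $\mathsf c(\gamma)$.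
   Context: An affine semigroup is a finitely generated submonoid of $\mathbb N^d$ with minimal generating set $\alpha_1,\ldots,\alpha_k$; $\varphi_\Gamma(z)=z_1\alpha_1+\cdots+z_k\alpha_k$, $\mathsf Z(\gamma)=\varphi_\Gamma^{-1}(\gamma)\subseteq\mathbb N^k$, $|z|=z_1+\cdots+z_k$, and $e_i$ is the $i$-th unit vector of $\mathbb N^k$. The Graver basis of $\Gamma$ is the minimal generating set of the affine semigroup $\{(z,w)\in\mathbb N^k\times\mathbb N^k:\varphi_\Gamma(z)=\varphi_\Gamma(w)\}$. For $z,w\in\mathbb N^k$, $\gcd(z,w)=(\min(z_1,w_1),\ldots,\min(z_k,w_k))$ and $\mathrm{dist}(z,w)=\max(|z-\gcd(z,w)|,|w-\gcd(z,w)|)$. An $N$-chain between $z,w\in\mathsf Z(\gamma)$ is a sequence $z=z_0,\ldots,z_r=w$ in $\mathsf Z(\gamma)$ with $\mathrm{dist}(z_{i-1},z_i)\le N$ for all $i$; the catenary degree $\mathsf c(\gamma)$ is the least $N\ge0$ such that any two factorizations of $\gamma$ are joined by an $N$-chain. *)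

theory Defs
  imports Main "HOL-Library.Function_Algebras" "HOL-Library.Product_Plus"
begin

text \<open>
  Vectors of length \<open>n\<close> are functions on \<open>nat\<close> vanishing outside \<open>{..<n}\<close>; indices are
  0-based. Addition and subtraction are pointwise.
\<close>

definition vecs :: "nat \<Rightarrow> (nat \<Rightarrow> 'a::zero) set" where
  "vecs n = {v. \<forall>i\<ge>n. v i = 0}"

definition unit_vec :: "nat \<Rightarrow> nat \<Rightarrow> nat" where
  "unit_vec i = (\<lambda>j. if j = i then 1 else 0)"

inductive_set monoid_span :: "'a::comm_monoid_add set \<Rightarrow> 'a set" for G where
  zero: "0 \<in> monoid_span G"
| add: "g \<in> G \<Longrightarrow> x \<in> monoid_span G \<Longrightarrow> g + x \<in> monoid_span G"

definition minimal_generating_set :: "'a::comm_monoid_add set \<Rightarrow> 'a set \<Rightarrow> bool" where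
  "minimal_generating_set G M \<longleftrightarrow>
     monoid_span G = M \<and> (\<forall>G'. G' \<subset> G \<longrightarrow> monoid_span G' \<noteq> M)"

definition affine_semigroup :: "nat \<Rightarrow> (nat \<Rightarrow> nat) set \<Rightarrow> bool" where
  "affine_semigroup d \<Gamma> \<longleftrightarrow> \<Gamma> \<subseteq> vecs d \<and> (\<exists>G. finite G \<and> monoid_span G = \<Gamma>)"

definition fact_hom :: "nat \<Rightarrow> (nat \<Rightarrow> nat \<Rightarrow> nat) \<Rightarrow> (nat \<Rightarrow> nat) \<Rightarrow> nat \<Rightarrow> nat" where
  "fact_hom k \<alpha> z = (\<lambda>j. \<Sum>i<k. z i * \<alpha> i j)"

text \<open>
  The argument \<open>\<beta>\<close> is an integer vector; the set is empty unless \<open>\<beta>\<close> lies in the semigroup.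
\<close>

definition factorizations ::
    "nat \<Rightarrow> (nat \<Rightarrow> nat \<Rightarrow> nat) \<Rightarrow> (nat \<Rightarrow> int) \<Rightarrow> (nat \<Rightarrow> nat) set" where
  "factorizations k \<alpha> \<beta> = {z \<in> vecs k. int \<circ> fact_hom k \<alpha> z = \<beta>}"

definition graver_basis ::
    "nat \<Rightarrow> (nat \<Rightarrow> nat \<Rightarrow> nat) \<Rightarrow> ((nat \<Rightarrow> nat) \<times> (nat \<Rightarrow> nat)) set \<Rightarrow> bool" where
  "graver_basis k \<alpha> H \<longleftrightarrow>
     minimal_generating_set H
       {(z, w). z \<in> vecs k \<and> w \<in> vecs k \<and> fact_hom k \<alpha> z = fact_hom k \<alpha> w}"

definition fact_length :: "nat \<Rightarrow> (nat \<Rightarrow> nat) \<Rightarrow> nat" where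
  "fact_length k z = (\<Sum>i<k. z i)"

definition fact_gcd :: "(nat \<Rightarrow> nat) \<Rightarrow> (nat \<Rightarrow> nat) \<Rightarrow> nat \<Rightarrow> nat" where
  "fact_gcd z w = (\<lambda>i. min (z i) (w i))"

definition fact_dist :: "nat \<Rightarrow> (nat \<Rightarrow> nat) \<Rightarrow> (nat \<Rightarrow> nat) \<Rightarrow> nat" where
  "fact_dist k z w =
     max (fact_length k (z - fact_gcd z w)) (fact_length k (w - fact_gcd z w))"

definition is_chain ::
    "nat \<Rightarrow> (nat \<Rightarrow> nat) set \<Rightarrow> nat \<Rightarrow> (nat \<Rightarrow> nat) \<Rightarrow> (nat \<Rightarrow> nat) \<Rightarrow> (nat \<Rightarrow> nat) list \<Rightarrow> bool" where
  "is_chain k Z N z w zs \<longleftrightarrow>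
     zs \<noteq> [] \<and> hd zs = z \<and> last zs = w \<and> set zs \<subseteq> Z \<and>
     successively (\<lambda>x y. fact_dist k x y \<le> N) zs"

definition catenary_degree :: "nat \<Rightarrow> (nat \<Rightarrow> nat \<Rightarrow> nat) \<Rightarrow> (nat \<Rightarrow> nat) \<Rightarrow> nat" where
  "catenary_degree k \<alpha> \<gamma> =
     (LEAST N. \<forall>z \<in> factorizations k \<alpha> (int \<circ> \<gamma>). \<forall>w \<in> factorizations k \<alpha> (int \<circ> \<gamma>).
        \<exists>zs. is_chain k (factorizations k \<alpha> (int \<circ> \<gamma>)) N z w zs)"

text \<open>
  Undirected graphs are given by a vertex set and a set of edges, an edge being the set of
  its endpoints.
\<close>

definition reachable :: "'v set set \<Rightarrow> 'v \<Rightarrow> 'v \<Rightarrow> bool" where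
  "reachable F x y \<longleftrightarrow> (x, y) \<in> {(a, b). {a, b} \<in> F}\<^sup>*"

definition is_cycle :: "'v set set \<Rightarrow> 'v list \<Rightarrow> bool" where
  "is_cycle F c \<longleftrightarrow>
     length c \<ge> 3 \<and> distinct c \<and> successively (\<lambda>x y. {x, y} \<in> F) c \<and> {last c, hd c} \<in> F"

definition is_tree :: "'v set \<Rightarrow> 'v set set \<Rightarrow> bool" where
  "is_tree V F \<longleftrightarrow>
     F \<subseteq> {{x, y} | x y. x \<in> V \<and> y \<in> V \<and> x \<noteq> y} \<and>
     (\<forall>x\<in>V. \<forall>y\<in>V. reachable F x y) \<and> (\<nexists>c. is_cycle F c)"

definition is_spanning_tree :: "'v set \<Rightarrow> 'v set set \<Rightarrow> 'v set set \<Rightarrow> bool" where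
  "is_spanning_tree V E F \<longleftrightarrow> F \<subseteq> E \<and> is_tree V F"

definition is_min_spanning_tree ::
    "'v set \<Rightarrow> 'v set set \<Rightarrow> ('v set \<Rightarrow> nat) \<Rightarrow> 'v set set \<Rightarrow> bool" where
  "is_min_spanning_tree V E wt F \<longleftrightarrow>
     is_spanning_tree V E F \<and> (\<forall>F'. is_spanning_tree V E F' \<longrightarrow> sum wt F \<le> sum wt F')"

definition kruskal_step :: "'v set \<Rightarrow> 'v set set \<Rightarrow> 'v set set" where
  "kruskal_step e F = (if \<forall>x\<in>e. \<forall>y\<in>e. reachable F x y then F else insert e F)"

text \<open>
  Kruskal's algorithm scans the edges by nondecreasing weight; since ties may be broken
  arbitrarily, its result is a relation: \<open>F\<close> is the output for some admissible order.
  An output exists for every finite \<open>E\<close>, connected or not.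
\<close>

definition kruskal_output :: "'v set set \<Rightarrow> ('v set \<Rightarrow> nat) \<Rightarrow> 'v set set \<Rightarrow> bool" where
  "kruskal_output E wt F \<longleftrightarrow>
     (\<exists>es. set es = E \<and> distinct es \<and> sorted (map wt es) \<and> F = fold kruskal_step es {})"

definition edge_dist :: "nat \<Rightarrow> (nat \<Rightarrow> nat) set \<Rightarrow> nat" where
  "edge_dist k e = (THE n. \<exists>z w. e = {z, w} \<and> n = fact_dist k z w)"

definition cover_image :: "nat \<Rightarrow> (nat \<Rightarrow> nat) set set \<Rightarrow> (nat \<Rightarrow> nat) set set" where
  "cover_image i F = (\<lambda>e. (\<lambda>z. z + unit_vec i) ` e) ` F"

definition candidate_edges ::
    "nat \<Rightarrow> (nat \<Rightarrow> nat \<Rightarrow> nat) \<Rightarrow> ((nat \<Rightarrow> nat) \<times> (nat \<Rightarrow> nat)) set \<Rightarrow>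
     ((nat \<Rightarrow> int) \<Rightarrow> (nat \<Rightarrow> nat) set set) \<Rightarrow> (nat \<Rightarrow> int) \<Rightarrow> (nat \<Rightarrow> nat) set set" where
  "candidate_edges k \<alpha> H T \<beta> =
     (\<Union>i<k. cover_image i (T (\<beta> - (int \<circ> \<alpha> i)))) \<union>
     {{z, w} | z w. (z, w) \<in> H \<and> z \<in> factorizations k \<alpha> \<beta> \<and> w \<in> factorizations k \<alpha> \<beta>}"

text \<open>
  \<open>T \<beta>\<close> is the edge set of the graph with vertex set \<open>factorizations k \<alpha> \<beta>\<close>. The
  factorization sets are finite because minimal generators are nonzero, so \<open>card\<close> is the
  true cardinality.
\<close>

definition recursive_trees ::
    "nat \<Rightarrow> nat \<Rightarrow> (nat \<Rightarrow> nat \<Rightarrow> nat) \<Rightarrow> ((nat \<Rightarrow> nat) \<times> (nat \<Rightarrow> nat)) set \<Rightarrow>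
     ((nat \<Rightarrow> int) \<Rightarrow> (nat \<Rightarrow> nat) set set) \<Rightarrow> bool" where
  "recursive_trees d k \<alpha> H T \<longleftrightarrow>
     (\<forall>\<beta> \<in> vecs d.
        if card (factorizations k \<alpha> \<beta>) \<le> 1 then T \<beta> = {}
        else kruskal_output (candidate_edges k \<alpha> H T \<beta>) (edge_dist k) (T \<beta>))"

definition max_edge_dist :: "nat \<Rightarrow> (nat \<Rightarrow> nat) set set \<Rightarrow> nat" where
  "max_edge_dist k F = (if F = {} then 0 else Max {fact_dist k z w | z w. {z, w} \<in> F})"

end

theory Submission
  imports Defs
begin

text \<open>
  For every bound N, the edges of \<open>T \<beta>\<close> of length at most N connect the same factorizations of
  \<open>\<beta>\<close> as all pairs at distance at most N. By induction on \<open>\<beta>\<close>, two factorizations sharing an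
  atom are joined inside a translate of a smaller tree; two coprime ones either form a Graver
  element or are joined through an intermediate factorization that shares an atom with each and
  is no farther from them than they are from each other. Kruskal's algorithm keeps connectivity at
  every threshold, and since its output is a forest, removing any edge disconnects it, so the
  longest edge is exactly the least N for which N-chains connect everything.
\<close>

section \<open>Reachability and forests\<close>

lemma reachable_refl [simp]: "reachable F x x"
  by (simp add: reachable_def)

lemma reachable_edge: "{x, y} \<in> F \<Longrightarrow> reachable F x y"
  by (auto simp: reachable_def)

lemma reachable_trans [trans]: "reachable F x y \<Longrightarrow> reachable F y z \<Longrightarrow> reachable F x z"
  unfolding reachable_def by (rule rtrancl_trans)

lemma reachable_sym:
  assumes "reachable F x y"
  shows "reachable F y x"
proof -
  have "sym {(a, b). {a, b} \<in> F}"
    by (auto simp: sym_def insert_commute)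
  then show ?thesis
    using assms unfolding reachable_def by (meson sym_rtrancl symD)
qed

lemma reachable_induct [consumes 1, case_names refl step]:
  assumes "reachable F x y" "P x"
    and "\<And>y z. reachable F x y \<Longrightarrow> {y, z} \<in> F \<Longrightarrow> P y \<Longrightarrow> P z"
  shows "P y"
  using assms(1) unfolding reachable_def
proof (induction rule: rtrancl_induct)
  case base
  show ?case by (rule assms(2))
next
  case (step y z)
  then show ?case using assms(3)[of y z] by (simp add: reachable_def)
qed

text \<open>Connectivity need only be transferred edge by edge. Contrapositively, if
  \<open>G\<close> separates \<open>x\<close> from \<open>y\<close>, some edge of \<open>F\<close>
  joins two different components of \<open>G\<close>; the exchange argument below uses this
  form.\<close>

lemma reachable_closure:
  assumes "reachable F x y" and "\<And>u v. {u, v} \<in> F \<Longrightarrow> reachable G u v"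
  shows "reachable G x y"
  using assms(1)
proof (induction rule: reachable_induct)
  case (step y z)
  show ?case by (rule reachable_trans[OF step.IH assms(2)[OF step.hyps(2)]])
qed simp

lemma reachable_mono: "reachable F x y \<Longrightarrow> F \<subseteq> G \<Longrightarrow> reachable G x y"
  by (erule reachable_closure) (auto intro: reachable_edge)

lemma reachable_image:
  assumes "reachable F x y"
  shows "reachable ((`) f ` F) (f x) (f y)"
  using assms
proof (induction rule: reachable_induct)
  case (step y z)
  have "{f y, f z} = f ` {y, z}" by simp
  then have "{f y, f z} \<in> (`) f ` F" using step.hyps(2) by blast
  then show ?case using step.IH reachable_edge reachable_trans by metis
qed simp

text \<open>A walk may cross the new edge many times, but crossing it back leads into the component
  it came from, so up to \<open>G\<close>-connectivity at most one crossing counts.\<close>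

lemma reachable_insertD:
  assumes "reachable (insert {x, y} G) a b"
  shows "reachable G a b \<or> reachable G a x \<and> reachable G y b \<or> reachable G a y \<and> reachable G x b"
  using assms
proof (induction rule: reachable_induct)
  case (step u v)
  show ?case
  proof (cases "{u, v} = {x, y}")
    case True
    then have "u = x \<and> v = y \<or> u = y \<and> v = x" by (auto simp: doubleton_eq_iff)
    then show ?thesis using step.IH by auto
  next
    case False
    then have "reachable G u v" using step.hyps(2) by (auto intro: reachable_edge)
    from reachable_trans[OF _ this] show ?thesis using step.IH by blast
  qed
qed simp

text \<open>Acyclicity is encoded as "every edge is a bridge", which suits exchange arguments better
  than cycles given as lists. Loops are excluded automatically, since every vertex reaches
  itself.\<close>

definition forest :: "'v set set \<Rightarrow> bool" where
  "forest F \<longleftrightarrow> (\<forall>e\<in>F. \<exists>x y. e = {x, y} \<and> \<not> reachable (F - {e}) x y)"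

lemma forestD:
  assumes "forest F" "{x, y} \<in> F"
  shows "\<not> reachable (F - {{x, y}}) x y"
proof -
  obtain u v where uv: "{x, y} = {u, v}" "\<not> reachable (F - {{x, y}}) u v"
    using assms unfolding forest_def by blast
  then have "u = x \<and> v = y \<or> u = y \<and> v = x" by (auto simp: doubleton_eq_iff)
  then show ?thesis using uv(2) reachable_sym by metis
qed

lemma forest_edge_neq: "forest F \<Longrightarrow> {x, y} \<in> F \<Longrightarrow> x \<noteq> y"
  using forestD[of F x y] by (cases "x = y") auto

lemma forest_edgeE:
  assumes "forest F" "e \<in> F"
  obtains x y where "e = {x, y}"
  using assms unfolding forest_def by blast

lemma forest_subset:
  assumes "forest F" "G \<subseteq> F"
  shows "forest G"
  unfolding forest_def
proof
  fix e assume e: "e \<in> G"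
  then have "e \<in> F" using assms(2) by blast
  then obtain x y where xy: "e = {x, y}" "\<not> reachable (F - {e}) x y"
    using assms(1)[unfolded forest_def] by metis
  have "G - {e} \<subseteq> F - {e}" using assms(2) by blast
  from reachable_mono[OF _ this] have "\<not> reachable (G - {e}) x y" using xy(2) by blast
  then show "\<exists>x y. e = {x, y} \<and> \<not> reachable (G - {e}) x y" using xy(1) by blast
qed

text \<open>If an old edge \<open>e = {a, b}\<close> ceased to be a bridge, the detour around it
  would have to cross \<open>{x, y}\<close>. The rest of the detour together with \<open>e\<close>
  would then join \<open>x\<close> to \<open>y\<close> inside \<open>F\<close>.\<close>

lemma forest_insert:
  assumes F: "forest F" and nr: "\<not> reachable F x y"
  shows "forest (insert {x, y} F)"
  unfolding forest_def
proof
  have nin: "{x, y} \<notin> F" using nr reachable_edge by metis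
  fix e assume "e \<in> insert {x, y} F"
  then consider "e = {x, y}" | "e \<in> F" "e \<noteq> {x, y}" by blast
  then show "\<exists>u v. e = {u, v} \<and> \<not> reachable (insert {x, y} F - {e}) u v"
  proof cases
    case 1
    then show ?thesis using nr nin by (intro exI[of _ x] exI[of _ y]) simp
  next
    case 2
    obtain a b where ab: "e = {a, b}" using forest_edgeE[OF F 2(1)] .
    define G where "G = F - {e}"
    have nG: "\<not> reachable G a b" using forestD[OF F] 2(1) unfolding ab G_def by blast
    have eq: "insert {x, y} F - {e} = insert {x, y} G" using 2 by (auto simp: G_def)
    have GF: "reachable F u v" if "reachable G u v" for u v
      using reachable_mono[OF that] by (auto simp: G_def)
    have abF: "reachable F a b" using 2(1) ab reachable_edge by metis
    have "\<not> reachable (insert {x, y} G) a b"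
    proof
      assume "reachable (insert {x, y} G) a b"
      then have "reachable G a x \<and> reachable G y b \<or> reachable G a y \<and> reachable G x b"
        using reachable_insertD nG by metis
      then show False
      proof (elim disjE conjE)
        assume "reachable G a x" "reachable G y b"
        then have "reachable F x a" "reachable F b y" by (auto intro: reachable_sym GF)
        from reachable_trans[OF this(1) reachable_trans[OF abF this(2)]] show False using nr by blast
      next
        assume "reachable G a y" "reachable G x b"
        then have "reachable F x b" "reachable F a y" by (auto intro: GF)
        from reachable_trans[OF this(1) reachable_trans[OF reachable_sym[OF abF] this(2)]]
        show False using nr by blast
      qed
    qed
    then show ?thesis using ab eq by auto
  qed
qed

text \<open>The exchange argument: an edge of A outside B is traded for an edge of a B-path that
  reconnects the two parts of A.\<close>

lemma forest_card_le:
  assumes "finite A" "finite B" "forest A" "forest B"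
    and "\<And>x y. {x, y} \<in> A \<Longrightarrow> reachable B x y"
  shows "card A \<le> card B"
  using assms(1,3,5)
proof (induction "card (A - B)" arbitrary: A rule: less_induct)
  case less
  show ?case
  proof (cases "A \<subseteq> B")
    case True
    then show ?thesis by (simp add: card_mono assms(2))
  next
    case False
    then obtain e where e: "e \<in> A" "e \<notin> B" by blast
    obtain x y where xy: "e = {x, y}" using forest_edgeE[OF less.prems(2) e(1)] .
    define G where "G = A - {e}"
    have nr: "\<not> reachable G x y" using forestD[OF less.prems(2)] e(1) unfolding xy G_def by blast
    have "reachable B x y" using less.prems(3) e(1) xy by blast
    \<comment> \<open>If every edge of \<open>B\<close> stayed within a component of
      \<open>G\<close>, then \<open>x\<close> and \<open>y\<close> would be connected in
      \<open>G\<close>.\<close>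
    then have "\<exists>u v. {u, v} \<in> B \<and> \<not> reachable G u v"
      using reachable_closure nr by metis
    then obtain u v where uv: "{u, v} \<in> B" "\<not> reachable G u v" by blast
    have uvG: "{u, v} \<notin> G" using uv(2) reachable_edge by metis
    define A' where "A' = insert {u, v} G"
    have fG: "finite G" using less.prems(1) by (simp add: G_def)
    have cA: "card A' = card A"
      using uvG fG e(1) less.prems(1) by (simp add: A'_def G_def card_Suc_Diff1 del: card_Diff_insert)
    \<comment> \<open>The exchange keeps the cardinality of \<open>A\<close> and removes
      \<open>e\<close> from the difference to \<open>B\<close>, so the induction measure
      drops.\<close>
    have "A' - B \<subset> A - B" using e uv(1) by (auto simp: A'_def G_def)
    then have "card (A' - B) < card (A - B)" using less.prems(1) by (simp add: psubset_card_mono)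
    moreover have "finite A'" using fG by (simp add: A'_def)
    moreover have "forest A'"
      unfolding A'_def using forest_subset[OF less.prems(2)] uv(2)
      by (intro forest_insert) (auto simp: G_def)
    moreover have "reachable B p q" if "{p, q} \<in> A'" for p q
    proof (cases "{p, q} \<in> B")
      case True
      then show ?thesis by (rule reachable_edge)
    next
      case False
      then have "{p, q} \<in> A" using that uv(1) by (auto simp: A'_def G_def)
      then show ?thesis by (rule less.prems(3))
    qed
    ultimately have "card A' \<le> card B" by (rule less.hyps)
    then show ?thesis using cA by simp
  qed
qed

section \<open>Bridges versus cycles\<close>

lemma reachable_distinct_path:
  assumes "reachable F x y"
  obtains p where "p \<noteq> []" "hd p = x" "last p = y" "distinct p"
    "successively (\<lambda>a b. {a, b} \<in> F) p"
proof -
  have "\<exists>p. p \<noteq> [] \<and> hd p = x \<and> last p = y \<and> distinct p \<and> successively (\<lambda>a b. {a, b} \<in> F) p"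
    using assms unfolding reachable_def
  proof (induction rule: converse_rtrancl_induct)
    case base
    show ?case by (rule exI[of _ "[y]"]) simp
  next
    case (step x z)
    then obtain p where p: "p \<noteq> []" "hd p = z" "last p = y" "distinct p"
      "successively (\<lambda>a b. {a, b} \<in> F) p" by blast
    show ?case
    proof (cases "x \<in> set p")
      case True
      \<comment> \<open>A path returning to \<open>x\<close> is cut back to the suffix that starts
        there, which keeps the vertices distinct.\<close>
      then obtain q r where qr: "p = q @ x # r" by (meson split_list)
      have "last (x # r) = y" "distinct (x # r)" "successively (\<lambda>a b. {a, b} \<in> F) (x # r)"
        using p(3-5) unfolding qr by (simp_all add: successively_append_iff)
      then show ?thesis by (intro exI[of _ "x # r"]) simp
    next
      case False
      have "successively (\<lambda>a b. {a, b} \<in> F) (x # p)"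
        using p step.hyps(1) by (cases p) auto
      then show ?thesis using p False by (intro exI[of _ "x # p"]) auto
    qed
  qed
  then show thesis using that by blast
qed

lemma successively_reachable:
  assumes "p \<noteq> []" "successively (\<lambda>a b. reachable F a b) p"
  shows "reachable F (hd p) (last p)"
  using assms
proof (induction p rule: induct_list012)
  case (3 x y zs)
  then show ?case using reachable_trans by (metis last_ConsR list.distinct(1) list.sel(1) successively.simps(3))
qed simp_all

text \<open>A simple detour around an edge that is not a bridge is closed by that edge to a
  cycle.\<close>

lemma forest_if_no_cycle:
  assumes edges: "\<And>e. e \<in> F \<Longrightarrow> \<exists>x y. e = {x, y} \<and> x \<noteq> y" and nc: "\<nexists>c. is_cycle F c"
  shows "forest F"
  unfolding forest_def
proof
  fix e assume e: "e \<in> F"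
  then obtain x y where xy: "e = {x, y}" "x \<noteq> y" using edges by blast
  have "\<not> reachable (F - {e}) x y"
  proof
    assume "reachable (F - {e}) x y"
    then obtain p where p: "p \<noteq> []" "hd p = x" "last p = y" "distinct p"
      "successively (\<lambda>a b. {a, b} \<in> F - {e}) p" by (rule reachable_distinct_path)
    \<comment> \<open>One vertex would force \<open>x = y\<close>, and two vertices would make the
      path consist of the removed edge \<open>e\<close>.\<close>
    have "length p \<ge> 3"
    proof (rule ccontr)
      assume "\<not> 3 \<le> length p"
      moreover have "length p \<noteq> 0" using p(1) by simp
      ultimately have "length p = 1 \<or> length p = 2" by linarith
      then consider a where "p = [a]" | a b where "p = [a, b]"
        by (auto simp: length_Suc_conv numeral_2_eq_2)
      then show False using p xy by cases auto
    qed
    moreover have "successively (\<lambda>a b. {a, b} \<in> F) p"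
      using p(5) by (rule successively_mono) auto
    moreover have "{last p, hd p} \<in> F" using e xy p by (simp add: insert_commute)
    ultimately have "is_cycle F p" using p(4) by (simp add: is_cycle_def)
    then show False using nc by blast
  qed
  then show "\<exists>x y. e = {x, y} \<and> \<not> reachable (F - {e}) x y" using xy by blast
qed

lemma no_cycle_if_forest:
  assumes "forest F"
  shows "\<not> is_cycle F c"
proof
  assume "is_cycle F c"
  then have c: "length c \<ge> 3" "distinct c" "successively (\<lambda>x y. {x, y} \<in> F) c" "{last c, hd c} \<in> F"
    by (auto simp: is_cycle_def)
  have ne: "c \<noteq> []" using c(1) by auto
  let ?e = "{last c, hd c}"
  have "successively (\<lambda>a b. reachable (F - {?e}) a b) c"
    unfolding successively_conv_nth
  proof (intro allI impI)
    fix i assume i: "Suc i < length c"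
    have "{c ! i, c ! Suc i} \<in> F" using c(3) i unfolding successively_conv_nth by blast
    \<comment> \<open>As the vertices are distinct, equal edges have equal index pairs; a
      consecutive pair could match the closing pair only in a list of length 2.\<close>
    moreover have "{c ! i, c ! Suc i} \<noteq> ?e"
    proof
      assume "{c ! i, c ! Suc i} = ?e"
      then have "{c ! i, c ! Suc i} = {c ! (length c - 1), c ! 0}"
        using ne by (simp add: last_conv_nth hd_conv_nth)
      then have "i = length c - 1 \<and> Suc i = 0 \<or> i = 0 \<and> Suc i = length c - 1"
        using i c(1,2) ne by (auto simp: doubleton_eq_iff nth_eq_iff_index_eq)
      then show False using c(1) by auto
    qed
    ultimately show "reachable (F - {?e}) (c ! i) (c ! Suc i)" by (intro reachable_edge) simp
  qed
  then have "reachable (F - {?e}) (hd c) (last c)" by (rule successively_reachable[OF ne])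
  then show False using forestD[OF assms c(4)] reachable_sym by metis
qed

section \<open>Kruskal's algorithm\<close>

lemma kruskal_step_cases:
  obtains "\<forall>x\<in>e. \<forall>y\<in>e. reachable F x y" "kruskal_step e F = F"
  | "\<not> (\<forall>x\<in>e. \<forall>y\<in>e. reachable F x y)" "kruskal_step e F = insert e F"
  by (cases "\<forall>x\<in>e. \<forall>y\<in>e. reachable F x y") (simp_all add: kruskal_step_def)

text \<open>When an edge is scanned, all edges kept so far weigh no more than it does. Hence a
  rejected edge is already bypassed by edges of at most its weight, and an accepted one is its own
  connection; later insertions preserve both.\<close>

lemma kruskal_fold:
  assumes "sorted (map wt es)" and "\<And>e. e \<in> set es \<Longrightarrow> \<exists>x y. e = {x, y}"
  shows "forest (fold kruskal_step es {}) \<and> fold kruskal_step es {} \<subseteq> set es \<and>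
    (\<forall>x y. {x, y} \<in> set es \<longrightarrow>
       reachable {g \<in> fold kruskal_step es {}. wt g \<le> wt {x, y}} x y)"
  using assms
proof (induction es rule: rev_induct)
  case Nil
  show ?case by (simp add: forest_def)
next
  case (snoc e es)
  define F where "F = fold kruskal_step es {}"
  define F' where "F' = fold kruskal_step (es @ [e]) {}"
  have F'eq: "F' = kruskal_step e F" by (simp add: F_def F'_def)
  have le: "\<forall>g\<in>set es. wt g \<le> wt e"
    using snoc.prems(1) by (auto simp: sorted_append)
  have "sorted (map wt es)" using snoc.prems(1) by (simp add: sorted_append)
  then have IH: "forest F" "F \<subseteq> set es"
    "\<And>x y. {x, y} \<in> set es \<Longrightarrow> reachable {g \<in> F. wt g \<le> wt {x, y}} x y"
    using snoc.IH snoc.prems(2) unfolding F_def by auto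
  obtain a b where ab: "e = {a, b}" using snoc.prems(2) by fastforce
  have sub: "F \<subseteq> F'" unfolding F'eq kruskal_step_def by auto
  have old: "reachable {g \<in> F'. wt g \<le> wt {x, y}} x y" if "{x, y} \<in> set es" for x y
    using IH(3)[OF that] by (rule reachable_mono) (use sub in auto)
  show ?case unfolding F'_def[symmetric]
  proof (cases rule: kruskal_step_cases[of e F])
    case 1
    have eq: "F' = F" using 1 F'eq by simp
    \<comment> \<open>By sortedness the threshold \<open>wt e\<close> filters out nothing.\<close>
    have all: "{g \<in> F'. wt g \<le> wt e} = F" using eq le IH(2) by auto
    have "reachable {g \<in> F'. wt g \<le> wt {x, y}} x y" if "{x, y} = e" for x y
      using 1(1) that all by auto
    then show "forest F' \<and> F' \<subseteq> set (es @ [e]) \<and>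
      (\<forall>x y. {x, y} \<in> set (es @ [e]) \<longrightarrow> reachable {g \<in> F'. wt g \<le> wt {x, y}} x y)"
      using old IH eq by auto
  next
    case 2
    have eq: "F' = insert e F" using 2 F'eq by simp
    have "\<not> reachable F a b" using 2(1) reachable_sym unfolding ab by fastforce
    then have "forest F'" unfolding eq ab by (rule forest_insert[OF IH(1)])
    moreover have "reachable {g \<in> F'. wt g \<le> wt {x, y}} x y" if "{x, y} = e" for x y
      using that eq by (intro reachable_edge) auto
    ultimately show "forest F' \<and> F' \<subseteq> set (es @ [e]) \<and>
      (\<forall>x y. {x, y} \<in> set (es @ [e]) \<longrightarrow> reachable {g \<in> F'. wt g \<le> wt {x, y}} x y)"
      using old IH(2) eq by auto
  qed
qed

lemma kruskal_output_properties:
  assumes "kruskal_output E wt F" and "\<And>e. e \<in> E \<Longrightarrow> \<exists>x y. e = {x, y}"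
  shows "finite E" "forest F" "F \<subseteq> E"
    and "\<And>x y. {x, y} \<in> E \<Longrightarrow> reachable {g \<in> F. wt g \<le> wt {x, y}} x y"
proof -
  obtain es where es: "set es = E" "sorted (map wt es)" "F = fold kruskal_step es {}"
    using assms(1) unfolding kruskal_output_def by blast
  show "finite E" using es(1) by auto
  show "forest F" "F \<subseteq> E" "\<And>x y. {x, y} \<in> E \<Longrightarrow> reachable {g \<in> F. wt g \<le> wt {x, y}} x y"
    using kruskal_fold[OF es(2)] assms(2) es(1,3) by auto
qed

section \<open>Minimality of the total weight\<close>

lemma sum_eq_sum_card_layers:
  fixes f :: "'a \<Rightarrow> nat"
  assumes "finite A" "\<And>a. a \<in> A \<Longrightarrow> f a \<le> M"
  shows "sum f A = (\<Sum>N<M. card {a \<in> A. N < f a})"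
proof -
  \<comment> \<open>A natural number is the count of the thresholds below it; swapping the two sums
    then counts, for each threshold, the elements above it.\<close>
  have "f a = (\<Sum>N<M. if N < f a then 1 else 0)" if "a \<in> A" for a
  proof -
    have "{..<M} \<inter> {N. N < f a} = {..<f a}" using assms(2)[OF that] by auto
    then show ?thesis by (simp add: sum.If_cases)
  qed
  then have "sum f A = (\<Sum>a\<in>A. \<Sum>N<M. if N < f a then 1 else 0)" by (intro sum.cong) auto
  also have "\<dots> = (\<Sum>N<M. \<Sum>a\<in>A. if N < f a then 1 else 0)" by (rule sum.swap)
  also have "\<dots> = (\<Sum>N<M. card {a \<in> A. N < f a})"
    using assms(1) by (intro sum.cong refl) (simp add: sum.inter_filter[symmetric])
  finally show ?thesis .
qed

text \<open>Minimality is a layer count: for every bound N the edges of F of weight at most N form a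
  maximal forest among the edges of weight at most N, so F has the fewest edges above N.\<close>

lemma kruskal_min_spanning_tree:
  assumes K: "kruskal_output E wt F"
    and edges: "\<And>e. e \<in> E \<Longrightarrow> \<exists>x y. e = {x, y} \<and> x \<in> V \<and> y \<in> V"
    and conn: "\<And>x y. x \<in> V \<Longrightarrow> y \<in> V \<Longrightarrow> reachable F x y"
  shows "is_min_spanning_tree V E wt F"
proof -
  have E: "\<And>e. e \<in> E \<Longrightarrow> \<exists>x y. e = {x, y}" using edges by blast
  note P = kruskal_output_properties[OF K E]
  have Fe: "F \<subseteq> {{x, y} | x y. x \<in> V \<and> y \<in> V \<and> x \<noteq> y}"
  proof
    fix e assume e: "e \<in> F"
    then obtain x y where "e = {x, y}" "x \<in> V" "y \<in> V" using edges P(3) by blast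
    moreover from this have "x \<noteq> y" using forest_edge_neq[OF P(2)] e by blast
    ultimately show "e \<in> {{x, y} | x y. x \<in> V \<and> y \<in> V \<and> x \<noteq> y}" by blast
  qed
  have span: "is_spanning_tree V E F"
    unfolding is_spanning_tree_def is_tree_def using P(3) Fe conn no_cycle_if_forest[OF P(2)] by blast
  have "sum wt F \<le> sum wt F'" if F': "is_spanning_tree V E F'" for F'
  proof -
    have sub: "F' \<subseteq> E" and pairs: "F' \<subseteq> {{x, y} | x y. x \<in> V \<and> y \<in> V \<and> x \<noteq> y}"
      and conn': "\<And>x y. x \<in> V \<Longrightarrow> y \<in> V \<Longrightarrow> reachable F' x y" and nc: "\<nexists>c. is_cycle F' c"
      using F' unfolding is_spanning_tree_def is_tree_def by auto
    have fF': "forest F'" using pairs by (intro forest_if_no_cycle[OF _ nc]) blast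
    have fin: "finite F" "finite F'" using P(1,3) sub finite_subset by auto
    \<comment> \<open>A weight bound shared by both trees, so that their sums run over the same
      layers; inserting 0 covers an empty \<open>E\<close>.\<close>
    define M where "M = Max (insert 0 (wt ` E))"
    have M: "wt e \<le> M" if "e \<in> E" for e using that P(1) by (simp add: M_def)
    have "card F \<le> card F'"
    proof (rule forest_card_le[OF fin P(2) fF'])
      fix x y assume "{x, y} \<in> F"
      then have "x \<in> V" "y \<in> V" using Fe by (auto simp: doubleton_eq_iff)
      then show "reachable F' x y" by (rule conn')
    qed
    have layer: "card {e \<in> F. N < wt e} \<le> card {e \<in> F'. N < wt e}" for N
    proof -
      have "card {e \<in> F'. wt e \<le> N} \<le> card {e \<in> F. wt e \<le> N}"
      proof (rule forest_card_le)
        fix x y assume xy: "{x, y} \<in> {e \<in> F'. wt e \<le> N}"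
        then have "reachable {g \<in> F. wt g \<le> wt {x, y}} x y" using P(4) sub by blast
        then show "reachable {e \<in> F. wt e \<le> N} x y" by (rule reachable_mono) (use xy in auto)
      qed (use fin forest_subset[OF P(2)] forest_subset[OF fF'] in auto)
      moreover have split: "card {e \<in> A. N < wt e} + card {e \<in> A. wt e \<le> N} = card A" if "finite A" for A
      proof -
        have "{e \<in> A. N < wt e} \<union> {e \<in> A. wt e \<le> N} = A" by auto
        then show ?thesis using that by (subst card_Un_disjoint[symmetric]) auto
      qed
      ultimately show ?thesis
        using split[OF fin(1)] split[OF fin(2)] \<open>card F \<le> card F'\<close> by linarith
    qed
    have "sum wt F = (\<Sum>N<M. card {e \<in> F. N < wt e})"
      using fin M P(3) by (intro sum_eq_sum_card_layers) auto
    also have "\<dots> \<le> (\<Sum>N<M. card {e \<in> F'. N < wt e})" by (intro sum_mono layer)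
    also have "\<dots> = sum wt F'"
      using fin M sub by (intro sum_eq_sum_card_layers[symmetric]) auto
    finally show ?thesis .
  qed
  then show ?thesis using span by (simp add: is_min_spanning_tree_def)
qed

section \<open>Factorizations and their distance\<close>

lemma fact_hom_add: "fact_hom k \<alpha> (z + w) = fact_hom k \<alpha> z + fact_hom k \<alpha> w"
  by (auto simp: fact_hom_def fun_eq_iff sum.distrib algebra_simps)

lemma fact_hom_unit_vec: "i < k \<Longrightarrow> fact_hom k \<alpha> (unit_vec i) = \<alpha> i"
  by (auto simp: fact_hom_def unit_vec_def fun_eq_iff if_distrib[of "\<lambda>x. x * _"] sum.delta cong: if_cong)

lemma fact_length_add: "fact_length k (z + w) = fact_length k z + fact_length k w"
  by (simp add: fact_length_def sum.distrib)

lemma fact_length_diff_le: "fact_length k (z - w) \<le> fact_length k z"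
  by (auto simp: fact_length_def intro: sum_mono)

lemma vecs_add_iff: "z + w \<in> vecs k \<longleftrightarrow> z \<in> vecs k \<and> w \<in> vecs k" for z w :: "nat \<Rightarrow> nat"
  by (auto simp: vecs_def)

lemma vecs_index_less: "v \<in> vecs n \<Longrightarrow> v i \<noteq> 0 \<Longrightarrow> i < n"
  by (metis (mono_tags, lifting) mem_Collect_eq not_le vecs_def)

lemma unit_vec_in_vecs: "i < k \<Longrightarrow> unit_vec i \<in> vecs k"
  by (auto simp: vecs_def unit_vec_def)

lemma fact_dist_sym: "fact_dist k z w = fact_dist k w z"
  by (simp add: fact_dist_def fact_gcd_def min.commute max.commute)

text \<open>A common summand is absorbed by the gcd. This is why cover morphisms preserve edge
  weights.\<close>

lemma fact_dist_add: "fact_dist k (z + v) (w + v) = fact_dist k z w"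
proof -
  have "(z + v) - fact_gcd (z + v) (w + v) = z - fact_gcd z w"
    "(w + v) - fact_gcd (z + v) (w + v) = w - fact_gcd z w"
    by (auto simp: fun_eq_iff fact_gcd_def min_def)
  then show ?thesis by (simp add: fact_dist_def)
qed

lemma fact_dist_le: "fact_dist k z w \<le> max (fact_length k z) (fact_length k w)"
  unfolding fact_dist_def by (intro max.mono fact_length_diff_le)

lemma fact_dist_disjoint:
  assumes "\<And>i. z i = 0 \<or> w i = 0"
  shows "fact_dist k z w = max (fact_length k z) (fact_length k w)"
proof -
  have "min (z i) (w i) = 0" for i using assms[of i] by auto
  then have "fact_gcd z w = 0" by (auto simp: fact_gcd_def fun_eq_iff)
  then show ?thesis by (simp add: fact_dist_def)
qed

text \<open>Symmetry of the distance makes the definite description in \<open>edge_dist\<close>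
  independent of the order of the endpoints.\<close>

lemma edge_dist_eq: "edge_dist k {z, w} = fact_dist k z w"
  unfolding edge_dist_def
proof (rule the_equality)
  fix n assume "\<exists>z' w'. {z, w} = {z', w'} \<and> n = fact_dist k z' w'"
  then show "n = fact_dist k z w" by (auto simp: doubleton_eq_iff fact_dist_sym)
qed blast

lemma diff_add_unit_vec: "0 < z i \<Longrightarrow> z - unit_vec i + unit_vec i = z"
  by (auto simp: fun_eq_iff unit_vec_def)

section \<open>Decomposition in monoid spans\<close>

lemma monoid_span_decompose:
  assumes "u \<in> monoid_span G"
  shows "u = 0 \<or> u \<in> G \<or> (\<exists>a\<in>monoid_span G. \<exists>b\<in>monoid_span G. a \<noteq> 0 \<and> b \<noteq> 0 \<and> u = a + b)"
  using assms
proof (induction rule: monoid_span.induct)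
  case (add g x)
  have "g \<in> monoid_span G" using monoid_span.add[OF add.hyps(1) monoid_span.zero] by simp
  \<comment> \<open>A zero summand is dropped; if neither \<open>g\<close> nor \<open>x\<close>
    vanishes, they are themselves the two parts.\<close>
  then show ?case using add by (cases "g = 0"; cases "x = 0") auto
qed simp

lemma monoid_span_remove_zero: "monoid_span (G - {0}) = monoid_span G"
proof
  show "monoid_span (G - {0}) \<subseteq> monoid_span G"
  proof
    fix x assume "x \<in> monoid_span (G - {0})"
    then show "x \<in> monoid_span G" by induction (auto intro: monoid_span.intros)
  qed
  show "monoid_span G \<subseteq> monoid_span (G - {0})"
  proof
    fix x assume "x \<in> monoid_span G"
    then show "x \<in> monoid_span (G - {0})"
    proof induction
      case (add g x)
      then show ?case by (cases "g = 0") (auto intro: monoid_span.intros)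
    qed (rule monoid_span.zero)
  qed
qed

text \<open>Dropping 0 does not change the span. Finiteness of the factorization sets and
  termination of the recursion both rest on this.\<close>

lemma minimal_generating_set_nonzero:
  assumes "minimal_generating_set G M" "g \<in> G"
  shows "g \<noteq> 0"
proof
  assume "g = 0"
  then have "G - {0} \<subset> G" using assms(2) by blast
  then show False
    using assms(1) monoid_span_remove_zero[of G] unfolding minimal_generating_set_def by metis
qed

section \<open>The recursive trees\<close>

locale recursive_tree_setting =
  fixes d k :: nat and \<alpha> :: "nat \<Rightarrow> nat \<Rightarrow> nat"
    and H :: "((nat \<Rightarrow> nat) \<times> (nat \<Rightarrow> nat)) set"
    and T :: "(nat \<Rightarrow> int) \<Rightarrow> (nat \<Rightarrow> nat) set set"
  assumes gens_vecs: "i < k \<Longrightarrow> \<alpha> i \<in> vecs d"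
    and gens_nonzero: "i < k \<Longrightarrow> \<alpha> i \<noteq> 0"
    and graver: "graver_basis k \<alpha> H"
    and trees: "recursive_trees d k \<alpha> H T"
begin

abbreviation Z :: "(nat \<Rightarrow> int) \<Rightarrow> (nat \<Rightarrow> nat) set" where
  "Z \<equiv> factorizations k \<alpha>"

abbreviation C :: "(nat \<Rightarrow> int) \<Rightarrow> (nat \<Rightarrow> nat) set set" where
  "C \<equiv> candidate_edges k \<alpha> H T"

section \<open>The coordinate sum as a grading\<close>

lemma gen_sum_pos:
  assumes "i < k"
  shows "0 < (\<Sum>j<d. \<alpha> i j)"
proof -
  obtain j where j: "\<alpha> i j \<noteq> 0" using gens_nonzero[OF assms] by (auto simp: fun_eq_iff)
  then have "j < d" using vecs_index_less[OF gens_vecs[OF assms]] by blast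
  then show ?thesis using j by (simp add: sum_pos2)
qed

text \<open>Each copy of an atom contributes at least 1 to the coordinate sum, so the total bounds
  every multiplicity.\<close>

lemma factorization_coord_le:
  assumes "z \<in> vecs k"
  shows "z i \<le> (\<Sum>j<d. fact_hom k \<alpha> z j)"
proof (cases "i < k")
  case True
  have "z i \<le> z i * (\<Sum>j<d. \<alpha> i j)" using gen_sum_pos[OF True] by simp
  also have "\<dots> \<le> (\<Sum>l<k. z l * (\<Sum>j<d. \<alpha> l j))"
    using True by (intro member_le_sum) auto
  also have "\<dots> = (\<Sum>j<d. fact_hom k \<alpha> z j)"
    unfolding fact_hom_def by (subst sum.swap) (simp add: sum_distrib_left)
  finally show ?thesis .
next
  case False
  then show ?thesis using assms by (simp add: vecs_def)
qed

lemma factorization_eq_zero: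
  assumes "z \<in> vecs k" "fact_hom k \<alpha> z = 0"
  shows "z = 0"
  using factorization_coord_le[OF assms(1)] assms(2) by (auto simp: fun_eq_iff)

text \<open>All factorizations lie in a box given by the coordinate sum. Finiteness makes the test
  \<open>card (Z \<beta>) \<le> 1\<close> genuine, because \<open>card\<close> of an infinite set
  would be 0.\<close>

lemma finite_factorizations: "finite (Z \<beta>)"
proof (cases "Z \<beta> = {}")
  case False
  then obtain z0 where z0: "z0 \<in> Z \<beta>" by blast
  define B where "B = (\<Sum>j<d. fact_hom k \<alpha> z0 j)"
  have "Z \<beta> \<subseteq> {z. \<forall>i. (i \<in> {..<k} \<longrightarrow> z i \<in> {..B}) \<and> (i \<notin> {..<k} \<longrightarrow> z i = 0)}"
  proof
    fix z assume z: "z \<in> Z \<beta>"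
    then have "int \<circ> fact_hom k \<alpha> z = int \<circ> fact_hom k \<alpha> z0" using z0 by (simp add: factorizations_def)
    then have "fact_hom k \<alpha> z = fact_hom k \<alpha> z0" by (simp add: fun_eq_iff)
    then have "z i \<le> B" for i
      using factorization_coord_le[of z i] z by (simp add: B_def factorizations_def)
    then show "z \<in> {z. \<forall>i. (i \<in> {..<k} \<longrightarrow> z i \<in> {..B}) \<and> (i \<notin> {..<k} \<longrightarrow> z i = 0)}"
      using z by (auto simp: factorizations_def vecs_def)
  qed
  moreover have "finite {z :: nat \<Rightarrow> nat. \<forall>i. (i \<in> {..<k} \<longrightarrow> z i \<in> {..B}) \<and> (i \<notin> {..<k} \<longrightarrow> z i = 0)}"
    by (rule finite_set_of_finite_funs) auto
  ultimately show ?thesis by (rule finite_subset)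
qed simp

text \<open>Over the integers the atom can be moved across the equation freely; if the difference
  has a negative coordinate, both sides fail.\<close>

lemma factorizations_shift:
  assumes "i < k"
  shows "z + unit_vec i \<in> Z \<beta> \<longleftrightarrow> z \<in> Z (\<beta> - (int \<circ> \<alpha> i))"
  using unit_vec_in_vecs[OF assms]
  by (auto simp: factorizations_def vecs_add_iff fact_hom_add fact_hom_unit_vec[OF assms] fun_eq_iff
    algebra_simps)

text \<open>Giving each pair its own distance as threshold handles all bounds N at once, and
  translation preserves the condition.\<close>

definition tree_invariant :: "(nat \<Rightarrow> int) \<Rightarrow> bool" where
  "tree_invariant \<beta> \<longleftrightarrow>
     (\<forall>e\<in>T \<beta>. \<exists>x y. e = {x, y} \<and> x \<in> Z \<beta> \<and> y \<in> Z \<beta>) \<and>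
     (\<forall>z\<in>Z \<beta>. \<forall>w\<in>Z \<beta>. reachable {e \<in> T \<beta>. edge_dist k e \<le> fact_dist k z w} z w)"

lemma tree_invariant_edge:
  assumes "tree_invariant \<beta>" "e \<in> T \<beta>"
  obtains x y where "e = {x, y}" "x \<in> Z \<beta>" "y \<in> Z \<beta>"
  using assms by (meson tree_invariant_def)

lemma tree_invariant_reachable:
  assumes "tree_invariant \<beta>" "z \<in> Z \<beta>" "w \<in> Z \<beta>"
  shows "reachable {e \<in> T \<beta>. edge_dist k e \<le> fact_dist k z w} z w"
  using assms by (simp add: tree_invariant_def)

lemma tree_empty:
  assumes "\<beta> \<in> vecs d" "card (Z \<beta>) \<le> 1"
  shows "T \<beta> = {}"
  using trees assms unfolding recursive_trees_def by metis

lemma tree_kruskal: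
  assumes "\<beta> \<in> vecs d" "\<not> card (Z \<beta>) \<le> 1"
  shows "kruskal_output (C \<beta>) (edge_dist k) (T \<beta>)"
  using trees assms unfolding recursive_trees_def by metis

lemma tree_invariant_trivial:
  assumes "\<beta> \<in> vecs d" "card (Z \<beta>) \<le> 1"
  shows "tree_invariant \<beta>"
proof -
  have "z = w" if "z \<in> Z \<beta>" "w \<in> Z \<beta>" for z w
    using that assms(2) finite_factorizations[of \<beta>] by (metis One_nat_def card_le_Suc0_iff_eq)
  then have "reachable {e \<in> T \<beta>. edge_dist k e \<le> fact_dist k z w} z w" if "z \<in> Z \<beta>" "w \<in> Z \<beta>" for z w
    using that reachable_refl by metis
  then show ?thesis using tree_empty[OF assms] by (simp add: tree_invariant_def)
qed

section \<open>Threshold connectivity of the candidate graph\<close>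

lemma candidate_edges_pairs:
  assumes pred: "\<And>i. i < k \<Longrightarrow> tree_invariant (\<beta> - (int \<circ> \<alpha> i))" and e: "e \<in> C \<beta>"
  shows "\<exists>x y. e = {x, y} \<and> x \<in> Z \<beta> \<and> y \<in> Z \<beta>"
proof -
  from e consider (cover) i e' where "i < k" "e' \<in> T (\<beta> - (int \<circ> \<alpha> i))" "e = (\<lambda>z. z + unit_vec i) ` e'"
    | (graver) "\<exists>x y. e = {x, y} \<and> x \<in> Z \<beta> \<and> y \<in> Z \<beta>"
    unfolding candidate_edges_def cover_image_def by blast
  then show ?thesis
  proof cases
    case cover
    then obtain x y where xy: "e' = {x, y}" "x \<in> Z (\<beta> - (int \<circ> \<alpha> i))" "y \<in> Z (\<beta> - (int \<circ> \<alpha> i))"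
      by (blast intro: tree_invariant_edge[OF pred])
    then have "x + unit_vec i \<in> Z \<beta>" "y + unit_vec i \<in> Z \<beta>"
      using factorizations_shift[OF cover(1)] by simp_all
    then show ?thesis using cover(3) xy(1)
      by (intro exI[of _ "x + unit_vec i"] exI[of _ "y + unit_vec i"]) simp
  qed assumption
qed

text \<open>Removing the shared atom keeps the distance. The invariant of the smaller tree gives a
  path, and its translate consists of candidate edges of unchanged weight.\<close>

lemma candidate_reachable_common:
  assumes pred: "tree_invariant (\<beta> - (int \<circ> \<alpha> i))"
    and i: "i < k" and z: "z \<in> Z \<beta>" "0 < z i" and w: "w \<in> Z \<beta>" "0 < w i"
  shows "reachable {e \<in> C \<beta>. edge_dist k e \<le> fact_dist k z w} z w"
proof -
  let ?\<beta> = "\<beta> - (int \<circ> \<alpha> i)" and ?f = "\<lambda>z. z + unit_vec i"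
  let ?z = "z - unit_vec i" and ?w = "w - unit_vec i"
  let ?S = "{e \<in> T ?\<beta>. edge_dist k e \<le> fact_dist k ?z ?w}"
  have zw: "?f ?z = z" "?f ?w = w" using diff_add_unit_vec[of z i] diff_add_unit_vec[of w i] z w by auto
  have d: "fact_dist k ?z ?w = fact_dist k z w" using fact_dist_add[of k ?z "unit_vec i" ?w] zw by simp
  have "?z \<in> Z ?\<beta>" "?w \<in> Z ?\<beta>" using factorizations_shift[OF i] zw z w by metis+
  then have "reachable ?S ?z ?w" by (rule tree_invariant_reachable[OF pred])
  then have "reachable ((`) ?f ` ?S) (?f ?z) (?f ?w)" by (rule reachable_image)
  moreover have "(`) ?f ` ?S \<subseteq> {e \<in> C \<beta>. edge_dist k e \<le> fact_dist k z w}"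
  proof
    fix e assume "e \<in> (`) ?f ` ?S"
    then obtain e' where e': "e' \<in> T ?\<beta>" "edge_dist k e' \<le> fact_dist k z w" "e = ?f ` e'"
      using d by auto
    obtain x y where xy: "e' = {x, y}" using tree_invariant_edge[OF pred e'(1)] by metis
    have "edge_dist k e = edge_dist k e'"
      unfolding e'(3) xy by (simp add: edge_dist_eq fact_dist_add)
    moreover have "e \<in> C \<beta>" using e' i unfolding candidate_edges_def cover_image_def by blast
    ultimately show "e \<in> {e \<in> C \<beta>. edge_dist k e \<le> fact_dist k z w}" using e' by simp
  qed
  ultimately show ?thesis unfolding zw by (rule reachable_mono)
qed

text \<open>If the coprime pair (z, w) is not itself a Graver element, it splits as
  (z1 + z2, w1 + w2), and w1 + z2 is an intermediate factorization sharing an atom with both ends.\<close>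

lemma candidate_reachable:
  assumes pred: "\<And>i. i < k \<Longrightarrow> tree_invariant (\<beta> - (int \<circ> \<alpha> i))"
    and z: "z \<in> Z \<beta>" and w: "w \<in> Z \<beta>"
  shows "reachable {e \<in> C \<beta>. edge_dist k e \<le> fact_dist k z w} z w"
proof (cases "\<exists>i. 0 < z i \<and> 0 < w i")
  case True
  then obtain i where i: "0 < z i" "0 < w i" by blast
  have "i < k" using i z by (auto simp: factorizations_def intro: vecs_index_less)
  then show ?thesis using candidate_reachable_common[OF pred _ z i(1) w i(2)] by simp
next
  case False
  define M where "M = {(z, w). z \<in> vecs k \<and> w \<in> vecs k \<and> fact_hom k \<alpha> z = fact_hom k \<alpha> w}"
  let ?R = "{e \<in> C \<beta>. edge_dist k e \<le> fact_dist k z w}"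
  have span: "monoid_span H = M"
    using graver by (simp add: M_def graver_basis_def minimal_generating_set_def)
  \<comment> \<open>For a coprime pair the distance is the larger of the full lengths, hence it
    dominates the lengths of all parts of \<open>z\<close> and \<open>w\<close>.\<close>
  have d: "fact_dist k z w = max (fact_length k z) (fact_length k w)"
    using False by (intro fact_dist_disjoint) auto
  have \<beta>: "\<beta> = int \<circ> fact_hom k \<alpha> z" "\<beta> = int \<circ> fact_hom k \<alpha> w"
    using z w by (auto simp: factorizations_def)
  then have "fact_hom k \<alpha> z = fact_hom k \<alpha> w" by (auto simp: fun_eq_iff)
  then have "(z, w) \<in> monoid_span H" unfolding span using z w by (simp add: M_def factorizations_def)
  from monoid_span_decompose[OF this] consider (zero) "(z, w) = 0" | (graver) "(z, w) \<in> H"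
    | (split) a b where "a \<in> M" "b \<in> M" "a \<noteq> 0" "b \<noteq> 0" "(z, w) = a + b"
    unfolding span by blast
  then show ?thesis
  proof cases
    case zero
    then show ?thesis by (simp add: zero_prod_def)
  next
    case graver
    then have "{z, w} \<in> C \<beta>" using z w unfolding candidate_edges_def by blast
    then show ?thesis by (intro reachable_edge) (simp add: edge_dist_eq)
  next
    case split
    obtain z1 w1 z2 w2 where ab: "a = (z1, w1)" "b = (z2, w2)" by (meson surj_pair)
    have eq: "z = z1 + z2" "w = w1 + w2" using split(5) ab by auto
    have v: "z1 \<in> vecs k" "w1 \<in> vecs k" "z2 \<in> vecs k" "w2 \<in> vecs k"
      and h: "fact_hom k \<alpha> z1 = fact_hom k \<alpha> w1" "fact_hom k \<alpha> z2 = fact_hom k \<alpha> w2"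
      using split(1,2) ab by (auto simp: M_def)
    have h0: "fact_hom k \<alpha> 0 = 0" by (simp add: fact_hom_def fun_eq_iff)
    \<comment> \<open>The only factorization of 0 is 0, so a nonzero pair in \<open>M\<close> has
      both components nonzero. Thus \<open>?m\<close> shares an atom of \<open>z2\<close> with
      \<open>z\<close> and one of \<open>w1\<close> with \<open>w\<close>.\<close>
    have "z2 \<noteq> 0"
    proof
      assume "z2 = 0"
      then have "w2 = 0" using h(2) h0 factorization_eq_zero[OF v(4)] by simp
      then show False using split(4) ab(2) \<open>z2 = 0\<close> by (simp add: zero_prod_def)
    qed
    moreover have "w1 \<noteq> 0"
    proof
      assume "w1 = 0"
      then have "z1 = 0" using h(1) h0 factorization_eq_zero[OF v(1)] by simp
      then show False using split(3) ab(1) \<open>w1 = 0\<close> by (simp add: zero_prod_def)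
    qed
    ultimately obtain i j where ij: "0 < z2 i" "0 < w1 j" by (auto simp: fun_eq_iff)
    have ijk: "i < k" "j < k" using vecs_index_less[OF v(3)] vecs_index_less[OF v(2)] ij by auto
    have len: "fact_length k z = fact_length k z1 + fact_length k z2"
      "fact_length k w = fact_length k w1 + fact_length k w2"
      unfolding eq by (rule fact_length_add)+
    let ?m = "w1 + z2"
    have m: "?m \<in> Z \<beta>"
      using v h \<beta>(1) eq by (simp add: factorizations_def vecs_add_iff fact_hom_add)
    \<comment> \<open>The common summand \<open>z2\<close> cancels, leaving the pair
      \<open>z1\<close>, \<open>w1\<close>; towards \<open>w\<close> the summand \<open>w1\<close>
      cancels in the same way.\<close>
    have "fact_dist k z ?m \<le> max (fact_length k z1) (fact_length k w1)"
      unfolding eq fact_dist_add by (rule fact_dist_le)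
    also have "\<dots> \<le> fact_dist k z w" unfolding d len by (intro max.mono) simp_all
    finally have d1: "fact_dist k z ?m \<le> fact_dist k z w" .
    have "fact_dist k ?m w = fact_dist k z2 w2"
      unfolding eq add.commute[of w1] by (rule fact_dist_add)
    also have "\<dots> \<le> max (fact_length k z2) (fact_length k w2)" by (rule fact_dist_le)
    also have "\<dots> \<le> fact_dist k z w" unfolding d len by (intro max.mono) simp_all
    finally have d2: "fact_dist k ?m w \<le> fact_dist k z w" .
    have "reachable {e \<in> C \<beta>. edge_dist k e \<le> fact_dist k z ?m} z ?m"
      using ij eq by (intro candidate_reachable_common[OF pred[OF ijk(1)] ijk(1) z _ m]) auto
    then have "reachable ?R z ?m" by (rule reachable_mono) (use d1 in auto)
    moreover have "reachable {e \<in> C \<beta>. edge_dist k e \<le> fact_dist k ?m w} ?m w"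
      using ij eq by (intro candidate_reachable_common[OF pred[OF ijk(2)] ijk(2) m _ w]) auto
    then have "reachable ?R ?m w" by (rule reachable_mono) (use d2 in auto)
    ultimately show ?thesis by (rule reachable_trans)
  qed
qed

text \<open>A path of short candidate edges becomes a path of short tree edges, since Kruskal
  replaces each candidate edge by tree edges of no larger weight.\<close>

lemma tree_invariant_step:
  assumes \<beta>: "\<beta> \<in> vecs d" and pred: "\<And>i. i < k \<Longrightarrow> tree_invariant (\<beta> - (int \<circ> \<alpha> i))"
  shows "tree_invariant \<beta>"
proof (cases "card (Z \<beta>) \<le> 1")
  case True
  then show ?thesis using tree_invariant_trivial \<beta> by blast
next
  case False
  have pairs: "\<exists>x y. e = {x, y}" if "e \<in> C \<beta>" for e
    using candidate_edges_pairs[OF pred that] by blast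
  note P = kruskal_output_properties[OF tree_kruskal[OF \<beta> False] pairs]
  have "reachable {e \<in> T \<beta>. edge_dist k e \<le> fact_dist k z w} z w" if "z \<in> Z \<beta>" "w \<in> Z \<beta>" for z w
    using candidate_reachable[OF pred that]
  proof (rule reachable_closure)
    fix u v assume uv: "{u, v} \<in> {e \<in> C \<beta>. edge_dist k e \<le> fact_dist k z w}"
    then have "reachable {g \<in> T \<beta>. edge_dist k g \<le> edge_dist k {u, v}} u v" using P(4) by blast
    then show "reachable {e \<in> T \<beta>. edge_dist k e \<le> fact_dist k z w} u v"
      by (rule reachable_mono) (use uv in auto)
  qed
  moreover have "\<exists>x y. e = {x, y} \<and> x \<in> Z \<beta> \<and> y \<in> Z \<beta>" if "e \<in> T \<beta>" for e
    using candidate_edges_pairs[OF pred] P(3) that by blast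
  ultimately show ?thesis unfolding tree_invariant_def by blast
qed

lemma shift_in_vecs:
  assumes "\<beta> \<in> vecs d" "i < k"
  shows "\<beta> - (int \<circ> \<alpha> i) \<in> vecs d"
  using assms(1) gens_vecs[OF assms(2)] by (simp add: vecs_def)

lemma tree_invariant_vecs:
  assumes "\<beta> \<in> vecs d"
  shows "tree_invariant \<beta>"
  using assms
proof (induction "nat (\<Sum>j<d. \<beta> j)" arbitrary: \<beta> rule: less_induct)
  case less
  show ?case
  proof (rule tree_invariant_step[OF less.prems])
    fix i assume i: "i < k"
    let ?\<beta> = "\<beta> - (int \<circ> \<alpha> i)"
    note \<beta>' = shift_in_vecs[OF less.prems i]
    \<comment> \<open>The sum over an integer vector may be negative, where \<open>nat\<close>
      truncates and the measure need not drop. If \<open>?\<beta>\<close> has a factorization, its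
      sum is nonnegative and the drop is strict; otherwise the invariant is trivial.\<close>
    show "tree_invariant ?\<beta>"
    proof (cases "Z ?\<beta> = {}")
      case True
      then show ?thesis using tree_invariant_trivial[OF \<beta>'] by simp
    next
      case False
      then obtain z where "z \<in> Z ?\<beta>" by blast
      then have "?\<beta> = int \<circ> fact_hom k \<alpha> z" by (simp add: factorizations_def)
      then have "0 \<le> (\<Sum>j<d. ?\<beta> j)" by (simp add: sum_nonneg)
      moreover have "(\<Sum>j<d. ?\<beta> j) = (\<Sum>j<d. \<beta> j) - int (\<Sum>j<d. \<alpha> i j)"
        by (simp add: sum_subtractf)
      ultimately have "nat (\<Sum>j<d. ?\<beta> j) < nat (\<Sum>j<d. \<beta> j)" using gen_sum_pos[OF i] by linarith
      then show ?thesis using less.hyps \<beta>' by blast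
    qed
  qed
qed

section \<open>Minimal spanning trees and the longest edge\<close>

lemma tree_reachable:
  assumes "\<beta> \<in> vecs d" "z \<in> Z \<beta>" "w \<in> Z \<beta>"
  shows "reachable {e \<in> T \<beta>. edge_dist k e \<le> fact_dist k z w} z w"
  using tree_invariant_reachable[OF tree_invariant_vecs[OF assms(1)] assms(2,3)] .

lemma tree_edges:
  assumes "\<beta> \<in> vecs d" "e \<in> T \<beta>"
  shows "\<exists>x y. e = {x, y} \<and> x \<in> Z \<beta> \<and> y \<in> Z \<beta>"
  using tree_invariant_edge[OF tree_invariant_vecs[OF assms(1)] assms(2)] by metis

lemma candidate_edges_vecs:
  assumes "\<beta> \<in> vecs d" "e \<in> C \<beta>"
  shows "\<exists>x y. e = {x, y} \<and> x \<in> Z \<beta> \<and> y \<in> Z \<beta>"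
  using candidate_edges_pairs[OF tree_invariant_vecs[OF shift_in_vecs[OF assms(1)]] assms(2)] .

text \<open>Kruskal's algorithm alone yields a forest; the invariant supplies connectivity on all of
  \<open>Z \<beta>\<close>.\<close>

lemma tree_min_spanning:
  assumes \<beta>: "\<beta> \<in> vecs d" and "\<not> card (Z \<beta>) \<le> 1"
  shows "is_min_spanning_tree (Z \<beta>) (C \<beta>) (edge_dist k) (T \<beta>)"
proof (rule kruskal_min_spanning_tree[OF tree_kruskal[OF assms] candidate_edges_vecs[OF \<beta>]])
  fix x y assume "x \<in> Z \<beta>" "y \<in> Z \<beta>"
  then have "reachable {e \<in> T \<beta>. edge_dist k e \<le> fact_dist k x y} x y" by (rule tree_reachable[OF \<beta>])
  then show "reachable (T \<beta>) x y" by (rule reachable_mono) auto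
qed

lemma tree_forest_finite:
  assumes \<beta>: "\<beta> \<in> vecs d"
  shows "forest (T \<beta>)" "finite (T \<beta>)"
proof -
  have "forest (T \<beta>) \<and> finite (T \<beta>)"
  proof (cases "card (Z \<beta>) \<le> 1")
    case True
    then show ?thesis using tree_empty[OF \<beta>] by (simp add: forest_def)
  next
    case False
    have pairs: "\<exists>x y. e = {x, y}" if "e \<in> C \<beta>" for e
      using candidate_edges_vecs[OF \<beta> that] by blast
    show ?thesis
      using kruskal_output_properties(1-3)[OF tree_kruskal[OF \<beta> False] pairs] finite_subset by blast
  qed
  then show "forest (T \<beta>)" "finite (T \<beta>)" by auto
qed

text \<open>The default 0 for an edgeless tree agrees with the vacuous right-hand side; otherwise
  \<open>Max\<close> ranges over a finite nonempty set.\<close>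

lemma max_edge_dist_le_iff:
  assumes \<beta>: "\<beta> \<in> vecs d"
  shows "max_edge_dist k (T \<beta>) \<le> N \<longleftrightarrow> (\<forall>z w. {z, w} \<in> T \<beta> \<longrightarrow> fact_dist k z w \<le> N)"
proof (cases "T \<beta> = {}")
  case True
  then show ?thesis by (simp add: max_edge_dist_def)
next
  case False
  let ?D = "{fact_dist k z w | z w. {z, w} \<in> T \<beta>}"
  have "?D \<subseteq> edge_dist k ` T \<beta>"
  proof
    fix n assume "n \<in> ?D"
    then obtain z w where zw: "{z, w} \<in> T \<beta>" and n: "n = edge_dist k {z, w}"
      by (auto simp: edge_dist_eq)
    then show "n \<in> edge_dist k ` T \<beta>" by blast
  qed
  then have "finite ?D" using tree_forest_finite(2)[OF \<beta>] by (meson finite_imageI finite_subset)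
  moreover have "?D \<noteq> {}"
  proof -
    obtain e where e: "e \<in> T \<beta>" using False by blast
    then obtain x y where "e = {x, y}" using tree_edges[OF \<beta> e] by blast
    then show ?thesis using e by blast
  qed
  ultimately show ?thesis using False by (auto simp: max_edge_dist_def)
qed

lemma chains_iff_max_edge_dist_le:
  assumes \<beta>: "\<beta> \<in> vecs d"
  shows "(\<forall>z\<in>Z \<beta>. \<forall>w\<in>Z \<beta>. \<exists>zs. is_chain k (Z \<beta>) N z w zs) \<longleftrightarrow> max_edge_dist k (T \<beta>) \<le> N"
proof
  assume le: "max_edge_dist k (T \<beta>) \<le> N"
  show "\<forall>z\<in>Z \<beta>. \<forall>w\<in>Z \<beta>. \<exists>zs. is_chain k (Z \<beta>) N z w zs"
  proof (intro ballI)
    fix z w assume zw: "z \<in> Z \<beta>" "w \<in> Z \<beta>"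
    have "reachable (T \<beta>) z w" using tree_reachable[OF \<beta> zw] by (rule reachable_mono) auto
    then show "\<exists>zs. is_chain k (Z \<beta>) N z w zs"
    proof (induction rule: reachable_induct)
      case refl
      show ?case using zw by (intro exI[of _ "[z]"]) (simp add: is_chain_def)
    next
      case (step u v)
      then obtain zs where zs: "is_chain k (Z \<beta>) N z u zs" by blast
      have "fact_dist k u v \<le> N" using le max_edge_dist_le_iff[OF \<beta>] step.hyps(2) by blast
      moreover have "v \<in> Z \<beta>" using tree_edges[OF \<beta> step.hyps(2)] by (auto simp: doubleton_eq_iff)
      ultimately have "is_chain k (Z \<beta>) N z v (zs @ [v])"
        using zs by (auto simp: is_chain_def successively_append_iff)
      then show ?case by blast
    qed
  qed
next
  assume chains: "\<forall>z\<in>Z \<beta>. \<forall>w\<in>Z \<beta>. \<exists>zs. is_chain k (Z \<beta>) N z w zs"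
  let ?R = "{e \<in> T \<beta>. edge_dist k e \<le> N}"
  show "max_edge_dist k (T \<beta>) \<le> N"
    unfolding max_edge_dist_le_iff[OF \<beta>]
  proof (intro allI impI)
    fix x y assume xy: "{x, y} \<in> T \<beta>"
    then have "x \<in> Z \<beta>" "y \<in> Z \<beta>" using tree_edges[OF \<beta> xy] by (auto simp: doubleton_eq_iff)
    then obtain zs where zs: "is_chain k (Z \<beta>) N x y zs" using chains by blast
    \<comment> \<open>Each link of the chain, which need not be a tree edge, is replaced by tree
      edges of length at most N.\<close>
    have "successively (reachable ?R) zs"
    proof (rule successively_mono)
      show "successively (\<lambda>x y. fact_dist k x y \<le> N) zs" using zs by (simp add: is_chain_def)
      fix u v assume uv: "u \<in> set zs" "v \<in> set zs" "fact_dist k u v \<le> N"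
      then have "reachable {e \<in> T \<beta>. edge_dist k e \<le> fact_dist k u v} u v"
        using zs by (intro tree_reachable[OF \<beta>]) (auto simp: is_chain_def)
      then show "reachable ?R u v" by (rule reachable_mono) (use uv in auto)
    qed
    then have "reachable ?R x y" using successively_reachable zs unfolding is_chain_def by metis
    \<comment> \<open>Were \<open>{x, y}\<close> longer than N, the short edges would join its ends
      without using it, although it is a bridge.\<close>
    from reachable_mono[OF this] have "\<not> ?R \<subseteq> T \<beta> - {{x, y}}"
      using forestD[OF tree_forest_finite(1)[OF \<beta>] xy] by blast
    then have "edge_dist k {x, y} \<le> N" by auto
    then show "fact_dist k x y \<le> N" by (simp add: edge_dist_eq)
  qed
qed

end

theorem theorem4p12:
  fixes d k :: nat
    and \<Gamma> :: "(nat \<Rightarrow> nat) set"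
    and \<alpha> :: "nat \<Rightarrow> nat \<Rightarrow> nat"
    and H :: "((nat \<Rightarrow> nat) \<times> (nat \<Rightarrow> nat)) set"
    and T :: "(nat \<Rightarrow> int) \<Rightarrow> (nat \<Rightarrow> nat) set set"
  assumes "affine_semigroup d \<Gamma>"
    and "inj_on \<alpha> {..<k}"
    and "minimal_generating_set (\<alpha> ` {..<k}) \<Gamma>"
    and "graver_basis k \<alpha> H"
    and "recursive_trees d k \<alpha> H T"
  shows "(\<forall>\<beta> \<in> vecs d. card (factorizations k \<alpha> \<beta>) > 1 \<longrightarrow>
            is_min_spanning_tree (factorizations k \<alpha> \<beta>) (candidate_edges k \<alpha> H T \<beta>)
              (edge_dist k) (T \<beta>))
       \<and> (\<forall>\<gamma> \<in> \<Gamma>. max_edge_dist k (T (int \<circ> \<gamma>)) = catenary_degree k \<alpha> \<gamma>)"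
proof -
  have \<Gamma>: "\<Gamma> \<subseteq> vecs d" using assms(1) by (simp add: affine_semigroup_def)
  have gen: "\<alpha> i \<in> \<Gamma>" if "i < k" for i
    using monoid_span.add[of "\<alpha> i" "\<alpha> ` {..<k}" 0] monoid_span.zero that assms(3)
    by (auto simp: minimal_generating_set_def)
  interpret recursive_tree_setting d k \<alpha> H T
  proof
    show "\<alpha> i \<in> vecs d" if "i < k" for i using gen[OF that] \<Gamma> by blast
    show "\<alpha> i \<noteq> 0" if "i < k" for i
      using minimal_generating_set_nonzero[OF assms(3)] that by blast
  qed (rule assms)+
  have "max_edge_dist k (T (int \<circ> \<gamma>)) = catenary_degree k \<alpha> \<gamma>" if "\<gamma> \<in> \<Gamma>" for \<gamma>
  proof -
    have "int \<circ> \<gamma> \<in> vecs d" using that \<Gamma> by (auto simp: vecs_def)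
    \<comment> \<open>The admissible bounds are exactly the numbers from the maximum upwards, so
      \<open>LEAST\<close> picks the maximum itself.\<close>
    from chains_iff_max_edge_dist_le[OF this] show ?thesis
      unfolding catenary_degree_def by (auto intro: Least_equality[symmetric])
  qed
  then show ?thesis using tree_min_spanning by auto
qed

end
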